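(* Let $A$ be a Pickands dependence function that is differentiable on $(0,1)$, let $C$ be the associated extreme-value copula, and let $\alpha$ and $\mathbb C$ be the Gaussian processes on $[0,1]^2$ defined in the context. Then for all $u,v,t\in[0,1]$, $$\mathrm{cov}\{\mathbb C(u^{1-t},u^t),\mathbb C(v^{1-t},v^t)\}\le \mathrm{cov}\{\alpha(u^{1-t},u^t),\alpha(v^{1-t},v^t)\}.$$
   Context: A Pickands dependence function is a convex function $A:[0,1]\to[1/2,1]$ with $\max(t,1-t)\le A(t)\le1$ for all $t\in[0,1]$. The associated extreme-value copula is the copula $C$ with $C(u,v)=(uv)^{A\{\log(v)/\log(uv)\}}$ for $(u,v)\in(0,1)^2$. $\alpha$ is a bivariate pinned $C$-Brownian sheet: a centered Gaussian random field on $[0,1]^2$ with covariance $\mathrm{cov}\{\alpha(u,v),\alpha(u',v')\}=C(u\wedge u',v\wedge v')-C(u,v)C(u',v')$, where $x\wedge y=\min(x,y)$. With $\dot C_1=\partial C/\partial u$, $\dot C_2=\partial C/\partial v$, $$\mathbb C(u,v)=\alpha(u,v)-\dot C_1(u,v)\,\alpha(u,1)-\dot C_2(u,v)\,\alpha(1,v),\qquad (u,v)\in[0,1]^2,$$ where on the boundary of the square a product whose $\alpha$-factor is almost surely zero (that is, $\alpha(0,1)$, $\alpha(1,0)$ or $\alpha(1,1)$) is read as $0$. The convention $0^0=1$ is used. *)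

theory Defs
  imports "HOL-Probability.Probability"
begin

definition pickands :: "(real \<Rightarrow> real) \<Rightarrow> bool" where
  "pickands A \<longleftrightarrow>
     convex_on {0..1} A \<and>
     (\<forall>t\<in>{0..1}. A t \<in> {1/2..1}) \<and>
     (\<forall>t\<in>{0..1}. max t (1 - t) \<le> A t \<and> A t \<le> 1)"

(* Bivariate copula: grounded, standard uniform margins, 2-increasing.
   The values of C outside the unit square are irrelevant. *)
definition copula :: "(real \<Rightarrow> real \<Rightarrow> real) \<Rightarrow> bool" where
  "copula C \<longleftrightarrow>
     (\<forall>u\<in>{0..1}. C u 0 = 0 \<and> C 0 u = 0) \<and>
     (\<forall>u\<in>{0..1}. C u 1 = u \<and> C 1 u = u) \<and>
     (\<forall>u\<in>{0..1}. \<forall>u'\<in>{0..1}. \<forall>v\<in>{0..1}. \<forall>v'\<in>{0..1}.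
        u \<le> u' \<longrightarrow> v \<le> v' \<longrightarrow> 0 \<le> C u' v' - C u' v - C u v' + C u v)"

definition extreme_value_copula :: "(real \<Rightarrow> real) \<Rightarrow> (real \<Rightarrow> real \<Rightarrow> real) \<Rightarrow> bool" where
  "extreme_value_copula A C \<longleftrightarrow>
     copula C \<and>
     (\<forall>u\<in>{0<..<1}. \<forall>v\<in>{0<..<1}. C u v = (u * v) powr A (ln v / ln (u * v)))"

definition cov :: "'w measure \<Rightarrow> ('w \<Rightarrow> real) \<Rightarrow> ('w \<Rightarrow> real) \<Rightarrow> real" where
  "cov M X Y =
     (\<integral>\<omega>. (X \<omega> - (\<integral>\<omega>'. X \<omega>' \<partial>M)) * (Y \<omega> - (\<integral>\<omega>'. Y \<omega>' \<partial>M)) \<partial>M)"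

(* The second disjunct admits degenerate (zero-variance) normal laws. *)
definition gaussian_rv :: "'w measure \<Rightarrow> ('w \<Rightarrow> real) \<Rightarrow> bool" where
  "gaussian_rv M X \<longleftrightarrow>
     X \<in> borel_measurable M \<and>
     ((\<exists>\<mu> \<sigma>. \<sigma> > 0 \<and> distributed M lborel X (normal_density \<mu> \<sigma>)) \<or>
      (\<exists>\<mu>. AE \<omega> in M. X \<omega> = \<mu>))"

definition gaussian_field :: "'w measure \<Rightarrow> 'i set \<Rightarrow> ('i \<Rightarrow> 'w \<Rightarrow> real) \<Rightarrow> bool" where
  "gaussian_field M I X \<longleftrightarrow>
     (\<forall>F c. finite F \<and> F \<subseteq> I \<longrightarrow> gaussian_rv M (\<lambda>\<omega>. \<Sum>i\<in>F. c i * X i \<omega>))"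

definition pinned_C_Brownian_sheet ::
  "'w measure \<Rightarrow> (real \<Rightarrow> real \<Rightarrow> real) \<Rightarrow> (real \<times> real \<Rightarrow> 'w \<Rightarrow> real) \<Rightarrow> bool" where
  "pinned_C_Brownian_sheet M C \<alpha> \<longleftrightarrow>
     gaussian_field M ({0..1} \<times> {0..1}) \<alpha> \<and>
     (\<forall>p\<in>{0..1} \<times> {0..1}. (\<integral>\<omega>. \<alpha> p \<omega> \<partial>M) = 0) \<and>
     (\<forall>u\<in>{0..1}. \<forall>v\<in>{0..1}. \<forall>u'\<in>{0..1}. \<forall>v'\<in>{0..1}.
        cov M (\<alpha> (u, v)) (\<alpha> (u', v')) = C (min u u') (min v v') - C u v * C u' v')"

definition dC1 :: "(real \<Rightarrow> real \<Rightarrow> real) \<Rightarrow> real \<Rightarrow> real \<Rightarrow> real" where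
  "dC1 C u v = deriv (\<lambda>x. C x v) u"

definition dC2 :: "(real \<Rightarrow> real \<Rightarrow> real) \<Rightarrow> real \<Rightarrow> real \<Rightarrow> real" where
  "dC2 C u v = deriv (\<lambda>y. C u y) v"

(* alpha(0,1), alpha(1,0) and alpha(1,1) vanish almost surely, and a product with one of
   these factors is read as 0. Hence dC1 is used only for 0 < u < 1 and dC2 only for
   0 < v < 1, where they are two-sided partial derivatives. *)
definition bbC ::
  "(real \<Rightarrow> real \<Rightarrow> real) \<Rightarrow> (real \<times> real \<Rightarrow> 'w \<Rightarrow> real) \<Rightarrow> real \<times> real \<Rightarrow> 'w \<Rightarrow> real" where
  "bbC C \<alpha> = (\<lambda>(u, v) \<omega>.
     \<alpha> (u, v) \<omega>
     - (if u = 0 \<or> u = 1 then 0 else dC1 C u v * \<alpha> (u, 1) \<omega>)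
     - (if v = 0 \<or> v = 1 then 0 else dC2 C u v * \<alpha> (1, v) \<omega>))"

(* Real power on the nonnegative reals with 0^0 = 1, whereas 0 powr 0 = 0. *)
definition rpow :: "real \<Rightarrow> real \<Rightarrow> real" where
  "rpow x a = (if a = 0 then 1 else x powr a)"

end

theory Submission
  imports Defs
begin

text \<open>
  Along the curve the two partial derivatives are C/x * (A t - t A' t) and
  C/y * (A t + (1 - t) A' t). The factors in parentheses are the heights at 0 and 1 of the
  tangent to A at t, so by convexity they lie in [0, 1]. For ordered points
  (x, y) \<le> (x', y') the difference of the two covariances is minus a sum of four
  products of a partial derivative with a bracket. Two brackets are nonnegative because
  x dC1 \<le> C and y dC2 \<le> C at (x, y). The other two, such as
  cov(\<alpha>(x, 1), \<alpha>(x', y')) - dC2(x', y') cov(\<alpha>(x, 1), \<alpha>(1, y')),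
  are nonnegative because C(x, y') \<ge> x y' (positive quadrant dependence, as A \<le> 1)
  and y' dC2(x', y') \<le> C(x', y') \<le> y'.
\<close>

section \<open>Covariances of square-integrable random variables\<close>

text \<open>\<open>cov\<close> is built from Bochner integrals, which default to 0 when the
  integrand is not integrable. Finite second moments rule this out and make \<open>cov\<close>
  bilinear.\<close>

definition square_integrable :: "'w measure \<Rightarrow> ('w \<Rightarrow> real) \<Rightarrow> bool" where
  "square_integrable M X \<longleftrightarrow> X \<in> borel_measurable M \<and> integrable M (\<lambda>\<omega>. (X \<omega>)\<^sup>2)"

lemma square_integrable_mult:
  assumes "square_integrable M X" "square_integrable M Y"
  shows "integrable M (\<lambda>\<omega>. X \<omega> * Y \<omega>)"
proof (rule Bochner_Integration.integrable_bound)
  show "integrable M (\<lambda>\<omega>. (X \<omega>)\<^sup>2 + (Y \<omega>)\<^sup>2)"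
    using assms by (auto simp: square_integrable_def)
  show "(\<lambda>\<omega>. X \<omega> * Y \<omega>) \<in> borel_measurable M"
    using assms by (auto simp: square_integrable_def)
  have "\<bar>x * y\<bar> \<le> \<bar>x\<^sup>2 + y\<^sup>2\<bar>" for x y :: real
    using sum_squares_bound[of "\<bar>x\<bar>" "\<bar>y\<bar>"] abs_ge_zero[of "x * y"]
    by (simp only: abs_mult power2_abs)
  then show "AE \<omega> in M. norm (X \<omega> * Y \<omega>) \<le> norm ((X \<omega>)\<^sup>2 + (Y \<omega>)\<^sup>2)"
    by simp
qed

text \<open>The shape \<open>X - c * Y\<close> is that of \<open>bbC\<close>, which performs two
  such subtractions.\<close>

lemma square_integrable_diff_cmult:
  assumes "square_integrable M X" "square_integrable M Y"
  shows "square_integrable M (\<lambda>\<omega>. X \<omega> - c * Y \<omega>)"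
proof -
  have "(\<lambda>\<omega>. (X \<omega> - c * Y \<omega>)\<^sup>2) =
      (\<lambda>\<omega>. (X \<omega>)\<^sup>2 - (2 * c) * (X \<omega> * Y \<omega>) + c\<^sup>2 * (Y \<omega>)\<^sup>2)"
    by (auto simp: power2_eq_square algebra_simps)
  then show ?thesis
    using assms square_integrable_mult[OF assms] by (auto simp: square_integrable_def)
qed

lemma cov_commute: "cov M X Y = cov M Y X"
  by (simp add: cov_def mult.commute)

context prob_space
begin

lemma integrable_of_square_integrable: "square_integrable M X \<Longrightarrow> integrable M X"
  using square_integrable_imp_integrable by (auto simp: square_integrable_def)

lemma square_integrable_gaussian_rv:
  assumes "gaussian_rv M X"
  shows "square_integrable M X"
proof -
  have [measurable]: "X \<in> borel_measurable M"
    using assms by (simp add: gaussian_rv_def)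
  consider \<mu> \<sigma> where "\<sigma> > 0" "distributed M lborel X (normal_density \<mu> \<sigma>)"
    | \<mu> where "AE \<omega> in M. X \<omega> = \<mu>"
    using assms by (auto simp: gaussian_rv_def)
  then have "integrable M (\<lambda>\<omega>. (X \<omega>)\<^sup>2)"
  proof cases
    case (1 \<mu> \<sigma>)
    \<comment> \<open>The second moment is split into the central second moment, the mean and the
      total mass, whose integrability is known.\<close>
    have "integrable lborel (\<lambda>x. normal_density \<mu> \<sigma> x * (x - \<mu>)\<^sup>2
        + (2 * \<mu>) * (normal_density \<mu> \<sigma> x * x) - \<mu>\<^sup>2 * normal_density \<mu> \<sigma> x)"
      using 1(1) by (intro Bochner_Integration.integrable_add Bochner_Integration.integrable_diff
          integrable_mult_right integrable_normal_moment integrable_normal_moment_nz_1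
          integrable_normal_density)
    also have "(\<lambda>x. normal_density \<mu> \<sigma> x * (x - \<mu>)\<^sup>2
        + (2 * \<mu>) * (normal_density \<mu> \<sigma> x * x) - \<mu>\<^sup>2 * normal_density \<mu> \<sigma> x)
        = (\<lambda>x. normal_density \<mu> \<sigma> x * x\<^sup>2)"
      by (auto simp: power2_eq_square algebra_simps)
    finally show ?thesis
      using distributed_integrable[OF 1(2), of "\<lambda>x. x\<^sup>2"] by simp
  next
    case (2 \<mu>)
    then have "integrable M (\<lambda>\<omega>. (X \<omega>)\<^sup>2) \<longleftrightarrow> integrable M (\<lambda>\<omega>. \<mu>\<^sup>2)"
      by (intro integrable_cong_AE) auto
    then show ?thesis by simp
  qed
  then show ?thesis by (simp add: square_integrable_def)
qed

lemma cov_eq: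
  assumes "square_integrable M X" "square_integrable M Y"
  shows "cov M X Y = (\<integral>\<omega>. X \<omega> * Y \<omega> \<partial>M) - (\<integral>\<omega>. X \<omega> \<partial>M) * (\<integral>\<omega>. Y \<omega> \<partial>M)"
  using integrable_of_square_integrable[OF assms(1)] integrable_of_square_integrable[OF assms(2)]
    square_integrable_mult[OF assms]
  by (simp add: cov_def left_diff_distrib right_diff_distrib prob_space)

lemma cov_diff_cmult_left:
  assumes "square_integrable M X" "square_integrable M Y" "square_integrable M Z"
  shows "cov M (\<lambda>\<omega>. X \<omega> - c * Y \<omega>) Z = cov M X Z - c * cov M Y Z"
  using assms[THEN integrable_of_square_integrable]
    square_integrable_mult[OF assms(1,3)] square_integrable_mult[OF assms(2,3)]
  by (simp add: cov_eq assms square_integrable_diff_cmult algebra_simps)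

lemma cov_diff_cmult_right:
  assumes "square_integrable M X" "square_integrable M Y" "square_integrable M Z"
  shows "cov M Z (\<lambda>\<omega>. X \<omega> - c * Y \<omega>) = cov M Z X - c * cov M Z Y"
  using cov_diff_cmult_left[OF assms] by (simp add: cov_commute)

text \<open>Zero variance makes \<open>X\<close> almost surely equal to its mean, so the centred
  product vanishes almost everywhere. This handles the corners of the square.\<close>

lemma cov_eq_0_of_variance_0:
  assumes X: "square_integrable M X" and "cov M X X = 0"
  shows "cov M X Y = 0"
proof -
  let ?f = "\<lambda>\<omega>. (X \<omega> - 1 * (\<integral>\<omega>'. X \<omega>' \<partial>M))\<^sup>2"
  have "square_integrable M (\<lambda>\<omega>. X \<omega> - 1 * (\<integral>\<omega>'. X \<omega>' \<partial>M))"
    using X by (intro square_integrable_diff_cmult) (auto simp: square_integrable_def)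
  then have "integrable M ?f"
    by (simp add: square_integrable_def)
  moreover have "(\<integral>\<omega>. ?f \<omega> \<partial>M) = 0"
    using assms(2) by (simp add: cov_def power2_eq_square)
  ultimately have "AE \<omega> in M. ?f \<omega> = 0"
    using integral_nonneg_eq_0_iff_AE[of M ?f] by simp
  then have "AE \<omega> in M. (X \<omega> - (\<integral>\<omega>'. X \<omega>' \<partial>M)) * (Y \<omega> - (\<integral>\<omega>'. Y \<omega>' \<partial>M)) = 0"
    by eventually_elim simp
  then show ?thesis
    unfolding cov_def by (rule integral_eq_zero_AE)
qed

end

section \<open>Pinned sheets\<close>

locale pinned_sheet = prob_space M for M :: "'w measure" +
  fixes C :: "real \<Rightarrow> real \<Rightarrow> real" and \<alpha> :: "real \<times> real \<Rightarrow> 'w \<Rightarrow> real"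
  assumes copula: "copula C"
    and sheet: "pinned_C_Brownian_sheet M C \<alpha>"
begin

lemma square_integrable_sheet:
  assumes "p \<in> {0..1} \<times> {0..1}"
  shows "square_integrable M (\<alpha> p)"
proof -
  have "gaussian_rv M (\<lambda>\<omega>. \<Sum>i\<in>{p}. 1 * \<alpha> i \<omega>)"
    using sheet assms unfolding pinned_C_Brownian_sheet_def gaussian_field_def
    by (elim conjE allE[of _ "{p}"] allE[of _ "\<lambda>_. 1"] impE) simp_all
  then show ?thesis
    by (intro square_integrable_gaussian_rv) simp
qed

lemma cov_sheet:
  assumes "u \<in> {0..1}" "v \<in> {0..1}" "u' \<in> {0..1}" "v' \<in> {0..1}"
  shows "cov M (\<alpha> (u, v)) (\<alpha> (u', v')) = C (min u u') (min v v') - C u v * C u' v'"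
  using sheet assms by (auto simp: pinned_C_Brownian_sheet_def)

lemma margins:
  assumes "u \<in> {0..1}"
  shows "C u 1 = u" "C 1 u = u" "C u 0 = 0" "C 0 u = 0"
  using copula assms by (auto simp: copula_def)

text \<open>Upper Frechet-Hoeffding bound: \<open>u - C u v\<close> and \<open>v - C u v\<close> are
  the \<open>C\<close>-volumes of the rectangles [0,u] x [v,1] and [u,1] x [0,v].\<close>

lemma C_le:
  assumes "u \<in> {0..1}" "v \<in> {0..1}"
  shows "C u v \<le> u" "C u v \<le> v"
proof -
  have two_inc: "0 \<le> C b d - C b c - C a d + C a c"
    if "a \<in> {0..1}" "b \<in> {0..1}" "c \<in> {0..1}" "d \<in> {0..1}" "a \<le> b" "c \<le> d" for a b c d
    using copula that by (auto simp: copula_def)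
  show "C u v \<le> u" using two_inc[of 0 u v 1] assms by (simp add: margins)
  show "C u v \<le> v" using two_inc[of u 1 0 v] assms by (simp add: margins)
qed

text \<open>At a corner \<open>C\<close> is 0 or 1, so the variance C - C^2 is 0.\<close>

lemma cov_vertex:
  assumes "x \<in> {0, 1}" "y \<in> {0, 1}"
  shows "cov M (\<alpha> (x, y)) Y = 0"
proof (rule cov_eq_0_of_variance_0)
  show "square_integrable M (\<alpha> (x, y))"
    using assms by (intro square_integrable_sheet) auto
  show "cov M (\<alpha> (x, y)) (\<alpha> (x, y)) = 0"
    using assms by (auto simp: cov_sheet margins)
qed

text \<open>The core inequality for a general copula. Quadrant dependence is required at the mixed
  points because \<open>C x y'\<close> and \<open>C x' y\<close> are the values that enter the
  covariances of a margin at one point with the sheet at the other.\<close>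

lemma cov_bbC_le:
  assumes pt: "x \<in> {0<..<1}" "y \<in> {0<..<1}" "x' \<in> {0<..<1}" "y' \<in> {0<..<1}"
    and le: "x \<le> x'" "y \<le> y'"
    and pqd: "x * y' \<le> C x y'" "x' * y \<le> C x' y"
    and c1: "0 \<le> dC1 C x y" "x * dC1 C x y \<le> C x y"
    and c2: "0 \<le> dC2 C x y" "y * dC2 C x y \<le> C x y"
    and c1': "0 \<le> dC1 C x' y'" "x' * dC1 C x' y' \<le> C x' y'"
    and c2': "0 \<le> dC2 C x' y'" "y' * dC2 C x' y' \<le> C x' y'"
  shows "cov M (bbC C \<alpha> (x, y)) (bbC C \<alpha> (x', y')) \<le> cov M (\<alpha> (x, y)) (\<alpha> (x', y'))"
proof -
  define a b c d where abcd: "a = dC1 C x y" "b = dC2 C x y" "c = dC1 C x' y'" "d = dC2 C x' y'"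
  define A0 A1 A2 where A: "A0 = \<alpha> (x, y)" "A1 = \<alpha> (x, 1)" "A2 = \<alpha> (1, y)"
  define B0 B1 B2 where B: "B0 = \<alpha> (x', y')" "B1 = \<alpha> (x', 1)" "B2 = \<alpha> (1, y')"
  note I = square_integrable_diff_cmult
  have sq: "square_integrable M A0" "square_integrable M A1" "square_integrable M A2"
    "square_integrable M B0" "square_integrable M B1" "square_integrable M B2"
    unfolding A B using pt by (auto intro!: square_integrable_sheet)
  have "bbC C \<alpha> (x, y) = (\<lambda>\<omega>. (A0 \<omega> - a * A1 \<omega>) - b * A2 \<omega>)"
    "bbC C \<alpha> (x', y') = (\<lambda>\<omega>. (B0 \<omega> - c * B1 \<omega>) - d * B2 \<omega>)"
    using pt by (auto simp: bbC_def abcd A B)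
  \<comment> \<open>Each of the four terms with two coefficients is paired with a different term
    with one coefficient, so every bracket retains a single coefficient.\<close>
  then have expand: "cov M (bbC C \<alpha> (x, y)) (bbC C \<alpha> (x', y')) =
      cov M A0 B0 - c * (cov M A0 B1 - a * cov M A1 B1) - d * (cov M A0 B2 - b * cov M A2 B2)
      - a * (cov M A1 B0 - d * cov M A1 B2) - b * (cov M A2 B0 - c * cov M A2 B1)"
    by (simp only: cov_diff_cmult_left cov_diff_cmult_right sq I) (simp add: algebra_simps)
  \<comment> \<open>Brackets pairing two values on the same margin: both covariances contain the
    factor \<open>1 - q\<close>, with \<open>q\<close> the coordinate of the larger point, which
    leaves \<open>r - p * s\<close>.\<close>
  have parallel: "0 \<le> r * (1 - q) - s * (p * (1 - q))" if "p * s \<le> r" "q \<le> 1" for p q r s :: real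
    using mult_right_mono[OF that(1), of "1 - q"] that(2) by (simp add: algebra_simps)
  \<comment> \<open>Brackets pairing different margins, in \<open>h3\<close> with E = C(x,y'), p =
    x, q = y', r = C(x',y'), s = dC2(x',y'). After multiplication by \<open>q\<close>, the bound
    \<open>q * s \<le> r\<close> removes the derivative, and \<open>r \<le> q\<close> with
    \<open>E \<ge> 0\<close> finishes.\<close>
  have crossed: "0 \<le> (E - p * r) - s * (E - p * q)"
    if "0 < q" "0 \<le> p" "p * q \<le> E" "q * s \<le> r" "r \<le> q" for E p q r s :: real
  proof -
    have "q * (s * (E - p * q)) \<le> r * (E - p * q)"
      using mult_right_mono[OF that(4), of "E - p * q"] that(3) by (simp add: algebra_simps)
    also have "\<dots> \<le> q * (E - p * r)"
    proof -
      have "0 \<le> (q - r) * E"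
        using that by (meson diff_ge_0_iff_ge less_imp_le mult_nonneg_nonneg order_trans)
      then show ?thesis by (simp add: algebra_simps)
    qed
    finally show ?thesis using that(1) by simp
  qed
  have le': "min x x' = x" "min y y' = y" "min x 1 = x" "min 1 x' = x'" "min y 1 = y" "min 1 y' = y'"
    using pt le by auto
  have h1: "0 \<le> cov M A0 B1 - a * cov M A1 B1"
    using parallel[OF c1(2), of x'] pt le'
    by (simp add: A B abcd cov_sheet margins algebra_simps)
  have h2: "0 \<le> cov M A0 B2 - b * cov M A2 B2"
    using parallel[OF c2(2), of y'] pt le'
    by (simp add: A B abcd cov_sheet margins algebra_simps)
  have h3: "0 \<le> cov M A1 B0 - d * cov M A1 B2"
    using crossed[of y' x "C x y'" d "C x' y'"] pt pqd c2' C_le[of x' y'] le'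
    by (simp add: A B abcd cov_sheet margins algebra_simps)
  have h4: "0 \<le> cov M A2 B0 - c * cov M A2 B1"
    using crossed[of x' y "C x' y" c "C x' y'"] pt pqd c1' C_le[of x' y'] le'
    by (simp add: A B abcd cov_sheet margins algebra_simps)
  show ?thesis
    unfolding expand unfolding A(1)[symmetric] B(1)[symmetric]
    using mult_nonneg_nonneg[OF c1'(1)[folded abcd] h1] mult_nonneg_nonneg[OF c2'(1)[folded abcd] h2]
      mult_nonneg_nonneg[OF c1(1)[folded abcd] h3] mult_nonneg_nonneg[OF c2(1)[folded abcd] h4]
    by linarith
qed

text \<open>On these sides \<open>C\<close> is the identity in the free variable, so its derivative
  is 1 and the margin term cancels the sheet itself; the other product is read as 0.\<close>

lemma bbC_margin:
  assumes "x \<in> {0<..<1}"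
  shows "bbC C \<alpha> (x, 1) = (\<lambda>_. 0)" "bbC C \<alpha> (1, x) = (\<lambda>_. 0)"
proof -
  have "((\<lambda>x. C x 1) has_field_derivative 1) (at x)"
    by (rule has_field_derivative_transform_within_open[where f = "\<lambda>x. x" and S = "{0<..<1}"])
      (use assms in \<open>auto simp: margins\<close>)
  then show "bbC C \<alpha> (x, 1) = (\<lambda>_. 0)"
    using assms by (auto simp: bbC_def dC1_def DERIV_imp_deriv)
  have "((\<lambda>x. C 1 x) has_field_derivative 1) (at x)"
    by (rule has_field_derivative_transform_within_open[where f = "\<lambda>x. x" and S = "{0<..<1}"])
      (use assms in \<open>auto simp: margins\<close>)
  then show "bbC C \<alpha> (1, x) = (\<lambda>_. 0)"
    using assms by (auto simp: bbC_def dC2_def DERIV_imp_deriv)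
qed

end

section \<open>Extreme-value copulas\<close>

text \<open>The tangent lies below \<open>A\<close>, hence its heights at 0 and 1 are at most
  \<open>A 0\<close> and \<open>A 1\<close>, so at most 1. Their convex combination with weights
  \<open>1 - t\<close> and \<open>t\<close> is \<open>A t\<close>. As one height is at most 1 and
  \<open>A t\<close> is at least \<open>t\<close> and \<open>1 - t\<close>, the other height is
  nonnegative.\<close>

lemma pickands_tangent:
  assumes "pickands A" "(A has_real_derivative D) (at t)" "t \<in> {0<..<1}"
  shows "A t - t * D \<in> {0..1}" "A t + (1 - t) * D \<in> {0..1}"
proof -
  have tangent: "A x - A t \<ge> D * (x - t)" if "x \<in> {0..1}" for x
    using assms that
    by (intro convex_on_imp_above_tangent[where A = "{0..1}"])
      (auto simp: pickands_def has_field_derivative_at_within)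
  have A: "A 0 \<le> 1" "A 1 \<le> 1" "t \<le> A t" "1 - t \<le> A t"
    using assms by (auto simp: pickands_def)
  have le1: "A t - t * D \<le> 1" "A t + (1 - t) * D \<le> 1"
    using tangent[of 0] tangent[of 1] A by (auto simp: algebra_simps)
  have "(1 - t) * (A t - t * D) = A t - t * (A t + (1 - t) * D)"
    by (simp add: algebra_simps)
  also have "\<dots> \<ge> 0"
    using mult_left_mono[OF le1(2), of t] assms(3) A(3)
    by (simp only: mult_1_right greaterThanLessThan_iff) linarith
  finally have "0 \<le> A t - t * D"
    using assms by (simp add: zero_le_mult_iff)
  moreover have "t * (A t + (1 - t) * D) = A t - (1 - t) * (A t - t * D)"
    by (simp add: algebra_simps)
  then have "t * (A t + (1 - t) * D) \<ge> 0"
    using mult_left_mono[OF le1(1), of "1 - t"] assms(3) A(4)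
    by (simp only: mult_1_right greaterThanLessThan_iff) linarith
  then have "0 \<le> A t + (1 - t) * D"
    using assms by (simp add: zero_le_mult_iff)
  ultimately show "A t - t * D \<in> {0..1}" "A t + (1 - t) * D \<in> {0..1}"
    using le1 by auto
qed

lemma ln_ratio_in_unit_interval:
  fixes x y :: real
  assumes "x \<in> {0<..<1}" "y \<in> {0<..<1}"
  shows "ln y / ln (x * y) \<in> {0<..<1}"
proof -
  have "ln x < 0" "ln y < 0" using assms by auto
  then have "0 < ln y / (ln x + ln y)" "ln y / (ln x + ln y) < 1"
    by (auto intro!: divide_neg_neg simp only: divide_less_eq_1_neg add_neg_neg)
  then show ?thesis
    using assms by (simp add: ln_mult)
qed

text \<open>The base \<open>x * y\<close> lies below 1, so lowering the exponent from 1 to a value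
  of \<open>A\<close> can only raise the power.\<close>

lemma extreme_value_copula_pqd:
  assumes "pickands A" "extreme_value_copula A C" "x \<in> {0<..<1}" "y \<in> {0<..<1}"
  shows "x * y \<le> C x y"
proof -
  have "(x * y) powr 1 \<le> (x * y) powr A (ln y / ln (x * y))"
  proof (rule powr_mono')
    show "A (ln y / ln (x * y)) \<le> 1"
      using assms ln_ratio_in_unit_interval[OF assms(3,4)] by (auto simp: pickands_def)
  qed (use assms in \<open>auto intro: mult_le_one\<close>)
  then show ?thesis
    using assms by (auto simp: extreme_value_copula_def)
qed

text \<open>Chain rule for exp(A(s) ln(xy)). Multiplying by \<open>x\<close> or \<open>y\<close>
  clears the denominator and leaves \<open>C\<close> times the height of the tangent at 0 or
  1.\<close>

lemma extreme_value_copula_derivs: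
  assumes C: "extreme_value_copula A C" and x: "x \<in> {0<..<1}" and y: "y \<in> {0<..<1}"
    and A: "(A has_real_derivative D) (at s)" and s: "s = ln y / ln (x * y)"
  shows "x * dC1 C x y = C x y * (A s - s * D)"
    and "y * dC2 C x y = C x y * (A s + (1 - s) * D)"
proof -
  let ?F = "\<lambda>x y. exp (A (ln y / (ln x + ln y)) * (ln x + ln y))"
  have F: "?F x y = C x y" if "x \<in> {0<..<1}" "y \<in> {0<..<1}" for x y
    using C that by (auto simp: extreme_value_copula_def powr_def ln_mult)
  have neg: "ln x + ln y < 0"
    using x y by (intro add_neg_neg) auto
  have s': "s = ln y / (ln x + ln y)"
    using x y by (simp add: s ln_mult)
  have A': "(A has_real_derivative D) (at (ln y / (ln x + ln y)))"
    using A by (simp add: s')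
  \<comment> \<open>The logarithm in this denominator later cancels against the factor
    \<open>ln x + ln y\<close> of the exponent.\<close>
  have "((\<lambda>x. ln y / (ln x + ln y)) has_real_derivative - s / (x * (ln x + ln y))) (at x)"
    using x neg
    by (auto intro!: derivative_eq_intros simp: s' divide_simps power2_eq_square)
  from DERIV_chain2[where f = A, OF _ this] A'
  have "((\<lambda>x. A (ln y / (ln x + ln y)))
      has_real_derivative D * (- s / (x * (ln x + ln y)))) (at x)"
    by blast
  moreover have "((\<lambda>x. ln x + ln y) has_real_derivative 1 / x) (at x)"
    using x by (auto intro!: derivative_eq_intros simp: divide_simps)
  ultimately have "((\<lambda>x. ?F x y) has_real_derivative ?F x y *
      (D * (- s / (x * (ln x + ln y))) * (ln x + ln y) + 1 / x * A s)) (at x)"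
    unfolding s' by (intro DERIV_fun_exp DERIV_mult)
  also have "D * (- s / (x * (ln x + ln y))) * (ln x + ln y) + 1 / x * A s = (A s - s * D) / x"
    using x neg by (simp add: divide_simps)
  \<comment> \<open>\<open>C\<close> has the explicit form only inside the unit square; an open
    interval around \<open>x\<close> suffices for the derivative.\<close>
  finally have "((\<lambda>x. C x y) has_real_derivative ?F x y * ((A s - s * D) / x)) (at x)"
    by (rule has_field_derivative_transform_within_open[where f = "\<lambda>x. ?F x y" and S = "{0<..<1}"])
      (use x y F in auto)
  then show "x * dC1 C x y = C x y * (A s - s * D)"
    using x y F by (simp add: dC1_def DERIV_imp_deriv)
  have "((\<lambda>y. ln y / (ln x + ln y)) has_real_derivative (1 - s) / (y * (ln x + ln y))) (at y)"
    using y neg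
    by (auto intro!: derivative_eq_intros simp: s' divide_simps power2_eq_square)
  from DERIV_chain2[where f = A, OF _ this] A'
  have "((\<lambda>y. A (ln y / (ln x + ln y)))
      has_real_derivative D * ((1 - s) / (y * (ln x + ln y)))) (at y)"
    by blast
  moreover have "((\<lambda>y. ln x + ln y) has_real_derivative 1 / y) (at y)"
    using y by (auto intro!: derivative_eq_intros simp: divide_simps)
  ultimately have "((\<lambda>y. ?F x y) has_real_derivative ?F x y *
      (D * ((1 - s) / (y * (ln x + ln y))) * (ln x + ln y) + 1 / y * A s)) (at y)"
    unfolding s' by (intro DERIV_fun_exp DERIV_mult)
  also have "D * ((1 - s) / (y * (ln x + ln y))) * (ln x + ln y) + 1 / y * A s
      = (A s + (1 - s) * D) / y"
    using y neg by (simp add: divide_simps)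
  finally have "((\<lambda>y. C x y) has_real_derivative ?F x y * ((A s + (1 - s) * D) / y)) (at y)"
    by (rule has_field_derivative_transform_within_open[where f = "\<lambda>y. ?F x y" and S = "{0<..<1}"])
      (use x y F in auto)
  then show "y * dC2 C x y = C x y * (A s + (1 - s) * D)"
    using x y F by (simp add: dC2_def DERIV_imp_deriv)
qed

text \<open>Since \<open>C x y \<ge> x * y \<ge> 0\<close>, multiplying it by a tangent height in
  [0,1] gives a value between 0 and \<open>C x y\<close>.\<close>

lemma extreme_value_copula_deriv_bounds:
  assumes P: "pickands A" and A: "A differentiable_on {0<..<1}"
    and C: "extreme_value_copula A C" and x: "x \<in> {0<..<1}" and y: "y \<in> {0<..<1}"
  shows "0 \<le> dC1 C x y" "x * dC1 C x y \<le> C x y" "0 \<le> dC2 C x y" "y * dC2 C x y \<le> C x y"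
proof -
  define s where s: "s = ln y / ln (x * y)"
  have s01: "s \<in> {0<..<1}"
    unfolding s by (rule ln_ratio_in_unit_interval[OF x y])
  then have "A differentiable at s"
    using A differentiable_on_eq_differentiable_at[of "{0<..<1}" A] by simp
  then obtain D where D: "(A has_real_derivative D) (at s)"
    by (auto simp: real_differentiable_def)
  note tan = pickands_tangent[OF P D s01]
  note der = extreme_value_copula_derivs[OF C x y D s]
  have "0 \<le> x * y" using x y by simp
  also have "\<dots> \<le> C x y" by (rule extreme_value_copula_pqd[OF P C x y])
  finally have pos: "0 \<le> C x y" .
  show "x * dC1 C x y \<le> C x y" "y * dC2 C x y \<le> C x y"
    using tan mult_left_mono[OF _ pos, of _ 1] by (auto simp: der)
  have "0 \<le> x * dC1 C x y" "0 \<le> y * dC2 C x y"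
    using tan pos by (auto simp: der)
  then show "0 \<le> dC1 C x y" "0 \<le> dC2 C x y"
    using x y by (auto simp: zero_le_mult_iff)
qed

section \<open>Covariances along the curve: corners, sides and interior\<close>

theorem proposition4p2:
  fixes A :: "real \<Rightarrow> real"
    and C :: "real \<Rightarrow> real \<Rightarrow> real"
    and M :: "'w measure"
    and \<alpha> :: "real \<times> real \<Rightarrow> 'w \<Rightarrow> real"
    and u v t :: real
  assumes "pickands A"
    and "A differentiable_on {0<..<1}"
    and "extreme_value_copula A C"
    and "prob_space M"
    and "pinned_C_Brownian_sheet M C \<alpha>"
    and "u \<in> {0..1}" and "v \<in> {0..1}" and "t \<in> {0..1}"
  shows "cov M (bbC C \<alpha> (rpow u (1 - t), rpow u t)) (bbC C \<alpha> (rpow v (1 - t), rpow v t))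
       \<le> cov M (\<alpha> (rpow u (1 - t), rpow u t)) (\<alpha> (rpow v (1 - t), rpow v t))"
  using assms(6,7)
proof (induction u v rule: linorder_wlog)
  case (sym u v)
  then show ?case by (simp add: cov_commute)
next
  case (le u v)
  interpret prob_space M by fact
  interpret pinned_sheet M C \<alpha>
    by unfold_locales (use assms in \<open>auto simp: extreme_value_copula_def\<close>)
  let ?p = "\<lambda>w. (rpow w (1 - t), rpow w t)"
  have vertex: "cov M (bbC C \<alpha> (?p w)) Y = 0" "cov M (\<alpha> (?p w)) Y = 0" if "w \<in> {0, 1}" for w Y
  proof -
    have "rpow w a \<in> {0, 1}" for a using that by (auto simp: rpow_def)
    moreover from this have "bbC C \<alpha> (?p w) = \<alpha> (?p w)"
      by (auto simp: bbC_def fun_eq_iff)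
    ultimately show "cov M (bbC C \<alpha> (?p w)) Y = 0" "cov M (\<alpha> (?p w)) Y = 0"
      by (simp_all add: cov_vertex)
  qed
  consider "u \<in> {0, 1}" | "v \<in> {0, 1}" | "u \<in> {0<..<1}" "v \<in> {0<..<1}"
    using le by force
  then show ?case
  proof cases
    case 1
    then show ?thesis by (simp add: vertex)
  next
    case 2
    then show ?thesis
      by (simp add: vertex cov_commute[of M "bbC C \<alpha> (?p u)"] cov_commute[of M "\<alpha> (?p u)"])
  next
    case 3
    \<comment> \<open>For \<open>t\<close> = 0 or 1 the curve runs along a side, where
      \<open>bbC\<close> vanishes and the right-hand covariance is \<open>u - u * v\<close>.\<close>
    have uv: "u * v \<le> u"
      using 3 by (simp add: mult_left_le)
    consider "t = 0" | "t = 1" | "t \<in> {0<..<1}"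
      using assms(8) by force
    then show ?thesis
    proof cases
      case 1
      then show ?thesis
        using 3 le uv by (simp add: rpow_def bbC_margin cov_sheet margins cov_def[of M "\<lambda>_. 0"])
    next
      case 2
      then show ?thesis
        using 3 le uv by (simp add: rpow_def bbC_margin cov_sheet margins cov_def[of M "\<lambda>_. 0"])
    next
      case t: 3
      have inside: "rpow w a \<in> {0<..<1}" if "w \<in> {0<..<1}" "0 < a" for w a
        using that powr_less_mono2[of a w 1] by (auto simp: rpow_def)
      have mono: "rpow u a \<le> rpow v a" if "0 < a" for a
        using that 3 le by (auto simp: rpow_def intro: powr_mono2)
      \<comment> \<open>For 0 < t < 1 the curve stays in the open square and increases in both
        coordinates, so \<open>u \<le> v\<close> yields ordered points.\<close>
      show ?thesis
        using 3 t
        by (intro cov_bbC_le inside mono extreme_value_copula_pqd[OF assms(1,3)]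
            extreme_value_copula_deriv_bounds[OF assms(1-3)]) auto
    qed
  qed
qed

end
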